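(* Fix positive integers $a,b,c,m$ with $\gcd(b,c)=1$ and $m\geq 2$. Then the equation $$\varphi(ax^m)=\frac{b\cdot n!}{c}$$ has only finitely many solutions in positive integers $x,n$, and every solution satisfies $n\leq\max\{61,3a,3b,3c\}$. In particular, all of the integer solutions to $\varphi(x^m)=n!$ with $m\geq 2$ are: $\varphi(1^m)=1!$, $\varphi(2^2)=2!$, $\varphi(3^2)=3!$, $\varphi((3\cdot 5)^2)=5!$, $\varphi((3\cdot 5\cdot 7)^2)=7!$, $\varphi((2^2\cdot 3\cdot 5\cdot 7)^2)=8!$, $\varphi((2^2\cdot 3^2\cdot 5\cdot 7)^2)=9!$, $\varphi((2^2\cdot 3^2\cdot 5\cdot 7\cdot 11)^2)=11!$, and $\varphi((2^2\cdot 3^2\cdot 5\cdot 7\cdot 11\cdot 13)^2)=13!$.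
   Context: $\varphi$ denotes Euler's totient function. $\mathbb{N}$ denotes the positive integers. *)

theory Defs
  imports Complex_Main "HOL-Number_Theory.Totient"
begin

end

theory Submission
  imports Defs "HOL-Number_Theory.Prime_Powers"
begin

text \<open>
  Let \<open>n > max {61, 3a, 3b, 3c}\<close> and \<open>y = a x^m\<close>. Every prime divisor of \<open>y\<close> is at most \<open>n\<close>.
  A prime \<open>p\<close> in \<open>(n/2, n]\<close> divides \<open>n!\<close> exactly once and divides no \<open>q - 1\<close> with \<open>q \<le> n\<close> prime, so
  the exponent of \<open>p\<close> in \<open>y\<close>, a multiple of \<open>m\<close>, is 2; hence \<open>m = 2\<close>. A prime \<open>p\<close> in \<open>(n/3, n/2]\<close> with
  \<open>p \<equiv> 1 (mod 3)\<close> divides \<open>n!\<close> exactly twice and again divides no \<open>q - 1\<close>, since \<open>2p + 1\<close> is a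
  multiple of 3. Its exponent in \<open>y\<close> would have to be 3, which contradicts \<open>m = 2\<close>.

  Such a \<open>p\<close> exists for every \<open>n \<ge> 62\<close>. With \<open>\<Lambda>\<close> the von Mangoldt function and \<open>\<chi>\<close> the nontrivial
  character modulo 3, the sums of \<open>\<Lambda>(d) \<lfloor>N/d\<rfloor>\<close> and of \<open>\<Lambda>(d) \<chi>(d) [\<lfloor>N/d\<rfloor> \<equiv> 1 (mod 3)]\<close> over \<open>d \<le> N\<close>
  are \<open>ln N!\<close> and \<open>O(ln N)\<close>. A suitable combination of them over \<open>N = \<lfloor>n/k\<rfloor>\<close> is less than
  \<open>-cn\<close>, but all its terms are nonnegative apart from the primes sought and a small remainder.

  For the equation \<open>\<phi>(x^m) = n!\<close> with \<open>n \<le> 61\<close>, again \<open>m = 2\<close>, and \<open>x \<phi>(x)\<close> determines \<open>x\<close> by descent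
  through the primes: the largest prime divisor of \<open>x\<close> has odd exponent \<open>2k - 1\<close> in \<open>x \<phi>(x)\<close>, where
  \<open>k\<close> is its exponent in \<open>x\<close>.
\<close>

section \<open>Primes congruent to 1 modulo 3\<close>

definition chi3 :: "nat \<Rightarrow> real" where
  "chi3 n = (if n mod 3 = 1 then 1 else if n mod 3 = 2 then - 1 else 0)"

lemma chi3_mult: "chi3 (a * b) = chi3 a * chi3 b"
proof -
  have "(a * b) mod 3 = ((a mod 3) * (b mod 3)) mod 3"
    by (simp add: mod_mult_eq)
  moreover have "a mod 3 = 0 \<or> a mod 3 = 1 \<or> a mod 3 = 2" "b mod 3 = 0 \<or> b mod 3 = 1 \<or> b mod 3 = 2"
    by linarith+
  ultimately show ?thesis
    by (elim disjE) (auto simp: chi3_def)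
qed

text \<open>The character sums to 0 over a full period. This is the source of the indicator of
  residue 1 modulo 3 in the twisted sums.\<close>

lemma sum_chi3: "(\<Sum>m=1..t. chi3 m) = (if t mod 3 = 1 then 1 else 0)"
proof (induction t)
  case (Suc t)
  have "t mod 3 = 0 \<or> t mod 3 = 1 \<or> t mod 3 = 2" by linarith
  thus ?case using Suc
    by (elim disjE) (auto simp: chi3_def mod_Suc)
qed auto

text \<open>Grouping the pairs \<open>(d, m)\<close> by \<open>j = d * m\<close> turns
  \<open>f d * f m\<close> into \<open>f j\<close>, and \<open>mangoldt\<close> sums to
  \<open>ln j\<close> over the divisors of \<open>j\<close>. The terms with \<open>d > M\<close>
  vanish, so one range \<open>{1..n}\<close> serves every \<open>M \<le> n\<close>.\<close>

lemma sum_mangoldt_mult: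
  fixes f :: "nat \<Rightarrow> real"
  assumes "\<And>a b. f (a * b) = f a * f b" and "M \<le> n"
  shows "(\<Sum>d=1..n. mangoldt d * f d * (\<Sum>m=1..M div d. f m)) = (\<Sum>j=1..M. f j * ln (real j))"
proof -
  have "(\<Sum>d=1..n. mangoldt d * f d * (\<Sum>m=1..M div d. f m)) =
        (\<Sum>d=1..M. \<Sum>m=1..M div d. mangoldt d * f (d * m))"
    using assms by (intro sum.mono_neutral_cong_right) (auto simp: sum_distrib_left algebra_simps)
  also have "\<dots> = (\<Sum>(d,m)\<in>(SIGMA d:{1..M}. {1..M div d}). mangoldt d * f (d * m))"
    by (rule sum.Sigma) auto
  also have "\<dots> = (\<Sum>(j,d)\<in>(SIGMA j:{1..M}. {d. d dvd j}). mangoldt d * f j)"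
  proof (rule sum.reindex_bij_witness[where i = "\<lambda>(j,d). (d, j div d)" and j = "\<lambda>(d,m). (d * m, d)"], goal_cases)
    case (2 a)
    then show ?case
      by (auto simp: Suc_le_eq less_eq_div_iff_mult_less_eq mult.commute)
  next
    case (4 b)
    obtain j d where b: "b = (j, d)" by (cases b)
    with 4 have j: "1 \<le> j" "j \<le> M" "d dvd j" by auto
    then have "d \<ge> 1" "d \<le> j" by (auto intro: dvd_imp_le Suc_leI Nat.gr0I)
    moreover have "1 \<le> j div d" using j by (auto elim!: dvdE)
    ultimately show ?case using j b by (auto intro: div_le_mono)
  qed auto
  also have "\<dots> = (\<Sum>j=1..M. \<Sum>d | d dvd j. mangoldt d * f j)"
    by (rule sum.Sigma [symmetric]) auto
  also have "\<dots> = (\<Sum>j=1..M. f j * ln (real j))"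
    using mangoldt_sum[where ?'a = real] by (intro sum.cong) (auto simp flip: sum_distrib_right)
  finally show ?thesis .
qed

lemma sum_mangoldt_div:
  assumes "M \<le> n"
  shows "(\<Sum>d=1..n. mangoldt d * real (M div d)) = ln (fact M)"
proof -
  have "(\<Sum>j=1..M. ln (real j)) = ln (fact M)"
    by (induction M) (auto simp: ln_mult)
  thus ?thesis using sum_mangoldt_mult[of "\<lambda>_. 1" M n] assms by simp
qed

text \<open>Each block contributes \<open>ln (3i+1) - ln (3i+2)\<close>, which lies between
  \<open>ln (3i+1) - ln (3i+4)\<close> and 0. By telescoping, the sum of the first \<open>i\<close>
  blocks stays between \<open>- ln (3i+1)\<close> and 0.\<close>

lemma sum_chi3_ln_bounds:
  "\<bar>\<Sum>j=1..M. chi3 j * ln (real j)\<bar> \<le> ln (real M + 1)"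
proof -
  define E where "E M = (\<Sum>j=1..M. chi3 j * ln (real j))" for M
  have S: "E (Suc M) = E M + chi3 (Suc M) * ln (real (Suc M))" for M
    by (simp add: E_def)
  have c: "chi3 (3 * i + 1) = 1" "chi3 (3 * i + 2) = - 1" "chi3 (3 * i + 3) = 0" for i
    unfolding chi3_def by (simp_all, presburger)
  have E1: "E (3 * i + 1) = E (3 * i) + ln (real (3 * i + 1))" for i
    using S[of "3 * i"] c(1)[of i] by simp
  have E2: "E (3 * i + 2) = E (3 * i) + ln (real (3 * i + 1)) - ln (real (3 * i + 2))" for i
    using S[of "3 * i + 1"] c(2)[of i] E1[of i] by simp
  have E0: "- ln (real (3 * i + 1)) \<le> E (3 * i) \<and> E (3 * i) \<le> 0" for i
  proof (induction i)
    case (Suc i)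
    have "E (3 * Suc i) = E (3 * i) + ln (real (3 * i + 1)) - ln (real (3 * i + 2))"
      using S[of "3 * i + 2"] c(3)[of i] E2[of i] by (simp add: numeral_3_eq_3)
    moreover have "ln (real (3 * i + 1)) \<le> ln (real (3 * i + 2))" "ln (real (3 * i + 2)) \<le> ln (real (3 * Suc i + 1))"
      by simp_all
    ultimately show ?case using Suc by linarith
  qed (simp add: E_def)
  define i where "i = M div 3"
  have "M = 3 * i \<or> M = 3 * i + 1 \<or> M = 3 * i + 2" unfolding i_def by presburger
  moreover have "ln (real (3 * i + 1)) \<le> ln (real (3 * i + 1 + 1))" "ln (real (3 * i + 2)) \<le> ln (real (3 * i + 2 + 1))"
    "0 \<le> ln (real (3 * i + 1))" "ln (real (3 * i + 1)) \<le> ln (real (3 * i + 2))"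
    by simp_all
  ultimately have "\<bar>E M\<bar> \<le> ln (real (M + 1))"
    unfolding abs_le_iff using E0[of i] E1[of i] E2[of i]
    by (elim disjE; hypsubst; intro conjI; linarith)
  thus ?thesis by (simp add: E_def add.commute)
qed

text \<open>First-order Stirling: \<open>v * ln v - v\<close> is an antiderivative of
  \<open>ln\<close>, and \<open>mono\<close> bounds its increments by the values of
  \<open>ln\<close> at the two ends. A real \<open>y\<close> admits
  \<open>y = n / k\<close>.\<close>

lemma ln_fact_bounds:
  fixes y :: real
  assumes "y \<ge> 1"
  shows "\<bar>ln (fact (nat \<lfloor>y\<rfloor>)) - (y * ln y - y + 1)\<bar> \<le> ln y"
proof -
  have mono: "v * ln v - v - (u * ln u - u) \<le> (v - u) * ln v"
             "(v - u) * ln u \<le> v * ln v - v - (u * ln u - u)" if "1 \<le> u" "u \<le> v" for u v :: real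
  proof -
    have "ln v - ln u \<le> (v - u) / u" "ln u - ln v \<le> (u - v) / v"
      using that ln_diff_le[of v u] ln_diff_le[of u v] by auto
    hence "u * (ln v - ln u) \<le> v - u" "v * (ln u - ln v) \<le> u - v"
      using that by (simp_all add: field_simps)
    thus "v * ln v - v - (u * ln u - u) \<le> (v - u) * ln v" "(v - u) * ln u \<le> v * ln v - v - (u * ln u - u)"
      by (auto simp: algebra_simps)
  qed
  define N where "N = nat \<lfloor>y\<rfloor>"
  have N: "N \<ge> 1" "real N \<le> y" "y \<le> real N + 1"
    using assms unfolding N_def by linarith+
  have lo: "N * ln N - N + 1 \<le> ln (fact N)" using N(1)
  proof (induction N rule: dec_induct)
    case (step n)
    have "ln (fact (Suc n)) = ln (Suc n) + ln (fact n :: real)"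
      by (simp add: ln_mult)
    with step mono(1)[of n "Suc n"] show ?case by simp
  qed simp
  have hi: "ln (fact N) \<le> N * ln N - N + 1 + ln N" using N(1)
  proof (induction N rule: dec_induct)
    case (step n)
    have "ln (fact (Suc n)) = ln (Suc n) + ln (fact n :: real)"
      by (simp add: ln_mult)
    with step mono(2)[of n "Suc n"] show ?case by simp
  qed simp
  have "(y - N) * ln y \<le> 1 * ln y" using N assms by (intro mult_right_mono) auto
  moreover have "(y - N) * ln N \<ge> 0" "ln N \<le> ln y" using N by auto
  moreover have "y * ln y - y - (N * ln N - N) \<le> (y - N) * ln y"
                "(y - N) * ln N \<le> y * ln y - y - (N * ln N - N)"
    using N by (intro mono; simp)+
  ultimately show ?thesis
    unfolding N_def [symmetric] abs_le_iff using lo hi by linarith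
qed

text \<open>Chebyshev's bound. With \<open>m = n div 2\<close>, every prime power in
  \<open>(n - m, n]\<close> has weight 1 in \<open>ln (n choose m)\<close>, which is at most
  \<open>2 * m * ln 2\<close>; induction covers the range up to \<open>n - m\<close>.\<close>

lemma sum_mangoldt_le: "(\<Sum>d=1..n. mangoldt d) \<le> real n * (2 * ln 2)"
proof (induction n rule: less_induct)
  case (less n)
  show ?case
  proof (cases "n \<le> 1")
    case True
    thus ?thesis by (cases n) auto
  next
    case False
    define m where "m = n div 2"
    have m: "m \<ge> 1" "m < n" "n - m < n" "m \<le> n - m" using False by (auto simp: m_def)
    have "(\<Sum>d=1..n. mangoldt d) = (\<Sum>d=1..n-m. mangoldt d) + (\<Sum>d=n-m+1..n. mangoldt d :: real)"
      using m sum.ub_add_nat[of 1 "n - m" "mangoldt :: nat \<Rightarrow> real" m] by simp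
    also have "(\<Sum>d=n-m+1..n. mangoldt d :: real) \<le>
        (\<Sum>d=1..n. mangoldt d * (real (n div d) - real (m div d) - real ((n - m) div d)))"
    proof -
      have "(\<Sum>d=n-m+1..n. mangoldt d :: real) = (\<Sum>d=n-m+1..n. mangoldt d * (real (n div d) - real (m div d) - real ((n - m) div d)))"
      proof (intro sum.cong refl, goal_cases)
        case (1 d)
        hence "n div d \<ge> 1" "n < 2 * d" using m by (auto simp: div_greater_zero_iff Suc_le_eq)
        hence "n div d = 1" by (intro antisym) (auto simp: div_less_iff_less_mult less_Suc_eq_le [symmetric])
        with 1 m show ?case by simp
      qed
      also have "\<dots> \<le> (\<Sum>d=1..n. mangoldt d * (real (n div d) - real (m div d) - real ((n - m) div d)))"
      proof (rule sum_mono2)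
        fix d
        have "m div d + (n - m) div d \<le> (m + (n - m)) div d"
          unfolding div_add1_eq[of m "n - m"] by (rule le_add1)
        hence "real (m div d) + real ((n - m) div d) \<le> real (n div d)"
          using m by (metis le_add_diff_inverse less_imp_le of_nat_add of_nat_le_iff)
        thus "0 \<le> mangoldt d * (real (n div d) - real (m div d) - real ((n - m) div d))"
          by (intro mult_nonneg_nonneg mangoldt_nonneg) linarith
      qed auto
      finally show ?thesis .
    qed
    also have "\<dots> = ln (fact n) - ln (fact m) - ln (fact (n - m))"
      using m sum_mangoldt_div[of n n] sum_mangoldt_div[of m n] sum_mangoldt_div[of "n-m" n]
      by (simp add: algebra_simps sum_subtractf sum.distrib)
    also have "\<dots> = ln (real (n choose m))"
      using m by (subst binomial_fact) (auto simp: ln_div ln_mult)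
    also have "\<dots> \<le> ln (2 ^ (2 * m))"
    proof -
      have "n choose m \<le> 2 ^ (2 * m)"
      proof (cases "even n")
        case True
        thus ?thesis using binomial_le_pow2[of n m] by (simp add: m_def)
      next
        case odd: False
        hence n: "n = 2 * m + 1" by (auto simp: m_def)
        \<comment> \<open>For odd \<open>n\<close> the two middle coefficients are equal and
          together at most \<open>2 ^ n\<close>, which saves a factor 2.\<close>
        have "2 * (n choose m) = (n choose m) + (n choose Suc m)"
          using binomial_symmetric[of m n] n by simp
        also have "\<dots> = (\<Sum>k\<in>{m, Suc m}. n choose k)" by simp
        also have "\<dots> \<le> (\<Sum>k\<le>n. n choose k)" using n by (intro sum_mono2) auto
        also have "\<dots> = 2 ^ n" by (rule choose_row_sum)
        finally show ?thesis using n by simp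
      qed
      hence "real (n choose m) \<le> 2 ^ (2 * m)"
        by (metis of_nat_le_iff of_nat_numeral of_nat_power)
      thus ?thesis using m by (subst ln_le_cancel_iff) auto
    qed
    also have "\<dots> = real m * (2 * ln 2)" by (simp add: ln_realpow)
    finally show ?thesis using less.IH[OF m(3)] m by (simp add: of_nat_diff algebra_simps)
  qed
qed

section \<open>Periodic weights and their verification over one period\<close>

text \<open>
  Each entry \<open>(k, h, g)\<close> contributes \<open>h \<lfloor>u/k\<rfloor>\<close> to the weight \<open>H\<close> of all prime powers and
  \<open>g [\<lfloor>u/k\<rfloor> \<equiv> 1 (mod 3)]\<close> to the weight \<open>G\<close> that is twisted by \<open>\<chi>\<close>, where \<open>u = \<lfloor>n/d\<rfloor>\<close>. The numbers
  were found by linear programming: they make the asymptotic value \<open>- \<Sum> h ln k / k\<close> negative subject to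
  \<open>\<Sum> h / k = 0\<close> and \<open>H \<plusminus> G \<ge> 0\<close>, except that \<open>H + G = -8\<close> at \<open>u = 2\<close>, the place of the primes sought.
  The constraint \<open>H \<plusminus> G \<ge> 0\<close> fails again at \<open>u = 422\<close>, as \<open>H\<close> has period 420; from there on \<open>H \<plusminus> G \<ge> -9\<close>
  has to do. As \<open>G\<close> has period 1260, the value \<open>u = 0\<close> below stands for the multiples of 1260.
\<close>

definition weights :: "(int \<times> int \<times> int) list" where
  "weights = [(2,-4,-4), (3,4,4), (4,4,-4), (6,0,4), (10,0,-4), (12,-4,0), (14,4,4), (21,1,-3),
     (28,-5,7), (42,-2,-4), (70,2,3), (140,-11,4), (210,-12,-2)]"

definition weight_H :: "int \<Rightarrow> int" where
  "weight_H u = (\<Sum>(k,h,g)\<leftarrow>weights. h * (u div k))"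

definition weight_G :: "int \<Rightarrow> int" where
  "weight_G u = (\<Sum>(k,h,g)\<leftarrow>weights. if (u div k) mod 3 = 1 then g else 0)"

definition weight_ok :: "int \<Rightarrow> bool" where
  "weight_ok u = (\<bar>weight_G u\<bar> \<le> weight_H u + (if u = 2 then 8 else if u = 0 \<or> u \<ge> 422 then 9 else 0))"

lemma weight_ok_0: "list_all weight_ok [0..104]"
  by code_simp

lemma weight_ok_1: "list_all weight_ok [105..209]"
  by code_simp

lemma weight_ok_2: "list_all weight_ok [210..314]"
  by code_simp

lemma weight_ok_3: "list_all weight_ok [315..419]"
  by code_simp

lemma weight_ok_4: "list_all weight_ok [420..524]"
  by code_simp

lemma weight_ok_5: "list_all weight_ok [525..629]"
  by code_simp

lemma weight_ok_6: "list_all weight_ok [630..734]"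
  by code_simp

lemma weight_ok_7: "list_all weight_ok [735..839]"
  by code_simp

lemma weight_ok_8: "list_all weight_ok [840..944]"
  by code_simp

lemma weight_ok_9: "list_all weight_ok [945..1049]"
  by code_simp

lemma weight_ok_10: "list_all weight_ok [1050..1154]"
  by code_simp

lemma weight_ok_11: "list_all weight_ok [1155..1259]"
  by code_simp

lemma weight_ok_range:
  assumes "u \<in> {0..<1260}"
  shows "weight_ok u"
proof -
  have range: "weight_ok u" if "list_all weight_ok [i..j]" "i \<le> u" "u \<le> j" for i j
    using that by (simp add: list_all_iff)
  have "u \<le> 104 \<or> 105 \<le> u \<and> u \<le> 209 \<or> 210 \<le> u \<and> u \<le> 314 \<or> 315 \<le> u \<and> u \<le> 419 \<or>
      420 \<le> u \<and> u \<le> 524 \<or> 525 \<le> u \<and> u \<le> 629 \<or> 630 \<le> u \<and> u \<le> 734 \<or> 735 \<le> u \<and> u \<le> 839 \<or>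
      840 \<le> u \<and> u \<le> 944 \<or> 945 \<le> u \<and> u \<le> 1049 \<or> 1050 \<le> u \<and> u \<le> 1154 \<or> 1155 \<le> u"
    by linarith
  thus ?thesis using assms
      range[OF weight_ok_0] range[OF weight_ok_1] range[OF weight_ok_2] range[OF weight_ok_3] range[OF weight_ok_4] range[OF weight_ok_5]
      range[OF weight_ok_6] range[OF weight_ok_7] range[OF weight_ok_8] range[OF weight_ok_9] range[OF weight_ok_10] range[OF weight_ok_11]
    by (elim disjE) auto
qed

text \<open>Every \<open>k\<close> divides 1260, so the shift adds \<open>1260 * q\<close> times the
  sum of \<open>h / k\<close>, which is 0.\<close>

lemma weight_H_periodic: "weight_H (u + 1260 * q) = weight_H u"
proof -
  have *: "(u + 1260 * q) div k = u div k + (1260 div k) * q" if "k dvd 1260" "k \<noteq> 0" for k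
  proof -
    from that obtain c where c: "1260 = k * c" by (auto elim: dvdE)
    hence "1260 div k = c" "u + 1260 * q = u + k * (c * q)"
      using that by (metis nonzero_mult_div_cancel_left, simp add: mult.assoc)
    moreover have "(u + k * (c * q)) div k = c * q + u div k"
      using that(2) by (rule div_mult_self2)
    ultimately show ?thesis by (simp only: add.commute)
  qed
  show ?thesis by (simp add: weight_H_def weights_def *)
qed

text \<open>Every \<open>3 * k\<close> divides 1260, so each quotient changes by a multiple of
  3.\<close>

lemma weight_G_periodic: "weight_G (u + 1260 * q) = weight_G u"
proof -
  have *: "(u + 1260 * q) div k mod 3 = (u div k) mod 3" if "(3 * k) dvd 1260" "k \<noteq> 0" for k
  proof -
    from that obtain c where "1260 = 3 * k * c" by (auto elim: dvdE)
    hence "u + 1260 * q = u + k * (3 * (c * q))" by simp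
    moreover have "(u + k * (3 * (c * q))) div k = 3 * (c * q) + u div k"
      using that(2) by (rule div_mult_self2)
    ultimately show ?thesis by (simp only: mod_mult_self4)
  qed
  show ?thesis by (simp add: weight_G_def weights_def *)
qed

lemma abs_weight_G_le:
  assumes "u \<ge> 1"
  shows "\<bar>weight_G u\<bar> \<le> weight_H u + (if u = 2 then 8 else if u \<ge> 422 then 9 else 0)"
proof (cases "u < 422")
  case True
  thus ?thesis using weight_ok_range[of u] assms by (auto simp: weight_ok_def split: if_splits)
next
  case False
  \<comment> \<open>Whatever the residue, including 0 and 2, its allowance is at most the 9 granted
    for \<open>u \<ge> 422\<close>.\<close>
  have "weight_ok (u mod 1260)" by (intro weight_ok_range) auto
  moreover have "weight_H u = weight_H (u mod 1260)" "weight_G u = weight_G (u mod 1260)"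
    using weight_H_periodic[of "u mod 1260" "u div 1260"] weight_G_periodic[of "u mod 1260" "u div 1260"]
    by (simp_all add: mod_mult_div_eq)
  ultimately show ?thesis using False by (auto simp: weight_ok_def split: if_splits)
qed

text \<open>Each entry contributes the two Mangoldt identities at \<open>M = n div k\<close>,
  because \<open>n div d div k = n div k div d\<close>.\<close>

lemma sum_mangoldt_weights:
  assumes "\<forall>(k,h,g)\<in>set ws. k \<ge> 2"
  shows "(\<Sum>d=1..n. mangoldt d *
            (real_of_int (\<Sum>(k,h,g)\<leftarrow>ws. h * (int (n div d) div k)) +
             chi3 d * real_of_int (\<Sum>(k,h,g)\<leftarrow>ws. if (int (n div d) div k) mod 3 = 1 then g else 0))) =
         (\<Sum>(k,h,g)\<leftarrow>ws. real_of_int h * ln (fact (n div nat k)) +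
             real_of_int g * (\<Sum>j=1..n div nat k. chi3 j * ln (real j)))"
  using assms
proof (induction ws)
  case (Cons w ws)
  obtain k h g where w: "w = (k, h, g)" by (cases w)
  define k' where "k' = nat k"
  have k: "k = int k'" "k' \<ge> 2" using Cons.prems w by (auto simp: k'_def)
  have le: "n div k' \<le> n" by simp
  have d: "int (n div d) div k = int (n div k' div d)" for d
    by (simp add: k(1) flip: zdiv_int div_mult2_eq) (simp add: mult.commute)
  have m: "(int x mod 3 = 1) = (x mod 3 = 1)" for x
    by presburger
  let ?T = "\<lambda>ws d. mangoldt d *
            (real_of_int (\<Sum>(k,h,g)\<leftarrow>ws. h * (int (n div d) div k)) +
             chi3 d * real_of_int (\<Sum>(k,h,g)\<leftarrow>ws. if (int (n div d) div k) mod 3 = 1 then g else 0))"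
  have "?T (w # ws) d = real_of_int h * (mangoldt d * real (n div k' div d)) +
      real_of_int g * (mangoldt d * chi3 d * (\<Sum>m=1..n div k' div d. chi3 m)) + ?T ws d" for d
    unfolding w sum_chi3 by (simp add: d m algebra_simps)
  hence "(\<Sum>d=1..n. ?T (w # ws) d) =
      real_of_int h * (\<Sum>d=1..n. mangoldt d * real (n div k' div d)) +
      real_of_int g * (\<Sum>d=1..n. mangoldt d * chi3 d * (\<Sum>m=1..n div k' div d. chi3 m)) + (\<Sum>d=1..n. ?T ws d)"
    by (simp only: sum.distrib sum_distrib_left)
  thus ?case
    using Cons.IH Cons.prems unfolding sum_mangoldt_div[OF le] sum_mangoldt_mult[OF chi3_mult le]
    by (simp add: w k'_def)
qed simp

section \<open>Upper and lower bounds for the weighted sum\<close>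

lemma weighted_sum_upper:
  assumes "n \<ge> 210"
  shows "(\<Sum>d=1..n. mangoldt d * (real_of_int (weight_H (int (n div d))) + chi3 d * real_of_int (weight_G (int (n div d)))))
    \<le> 100 * ln (real n) - real n * (\<Sum>(k,h,g)\<leftarrow>weights. real_of_int h * ln (real_of_int k) / real_of_int k)"
proof -
  have k: "2 \<le> k \<and> k \<le> 210" if "(k,h,g) \<in> set weights" for k h g
    using that by (auto simp: weights_def)
  have "(\<Sum>d=1..n. mangoldt d * (real_of_int (weight_H (int (n div d))) + chi3 d * real_of_int (weight_G (int (n div d)))))
     = (\<Sum>(k,h,g)\<leftarrow>weights. real_of_int h * ln (fact (n div nat k)) +
             real_of_int g * (\<Sum>j=1..n div nat k. chi3 j * ln (real j)))"
    unfolding weight_H_def weight_G_def by (rule sum_mangoldt_weights) (use k in auto)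
  also have "\<dots> \<le> (\<Sum>(k,h,g)\<leftarrow>weights. real_of_int h * (real n / real_of_int k * (ln (real n) - ln (real_of_int k) - 1) + 1) +
      (\<bar>real_of_int h\<bar> + \<bar>real_of_int g\<bar>) * ln (real n))"
  proof (rule sum_list_mono, clarify)
    fix k h g assume "(k,h,g) \<in> set weights"
    note k = k[OF this]
    define y where "y = real n / k"
    define F where "F = ln (fact (n div nat k) :: real)"
    define E where "E = (\<Sum>j=1..n div nat k. chi3 j * ln (real j))"
    have y: "y \<ge> 1" "y \<le> real n / 2" using k assms by (auto simp: y_def field_simps)
    have "nat \<lfloor>y\<rfloor> = n div nat k"
      using k floor_divide_of_nat_eq[of n "nat k", where ?'a = real] by (simp add: y_def)
    hence "\<bar>F - (y * ln y - y + 1)\<bar> \<le> ln y"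
      using ln_fact_bounds[OF y(1)] by (simp add: F_def)
    also have "ln y \<le> ln (real n)" using y by simp
    also have "y * ln y - y + 1 = y * (ln (real n) - ln k - 1) + 1"
      using k assms by (simp add: y_def ln_div algebra_simps add_divide_distrib)
    finally have F: "\<bar>F - (y * (ln (real n) - ln k - 1) + 1)\<bar> \<le> ln (real n)" .
    have "real (n div nat k) \<le> y" using k of_nat_div_le_of_nat[of n "nat k", where ?'a = real] by (simp add: y_def)
    hence "ln (real (n div nat k) + 1) \<le> ln (real n)"
      using y assms by (subst ln_le_cancel_iff) auto
    hence E: "\<bar>E\<bar> \<le> ln (real n)" using sum_chi3_ln_bounds[of "n div nat k"] by (simp add: E_def)
    have "h * (F - (y * (ln (real n) - ln k - 1) + 1)) \<le> \<bar>real_of_int h\<bar> * ln (real n)"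
      using mult_left_mono[OF F, of "\<bar>real_of_int h\<bar>"] by (simp flip: abs_mult) 
    moreover have "g * E \<le> \<bar>real_of_int g\<bar> * ln (real n)"
      using mult_left_mono[OF E, of "\<bar>real_of_int g\<bar>"] by (simp flip: abs_mult) 
    ultimately show "h * F + g * E \<le> h * (real n / real_of_int k * (ln (real n) - ln (real_of_int k) - 1) + 1) +
      (\<bar>real_of_int h\<bar> + \<bar>real_of_int g\<bar>) * ln (real n)"
      by (simp add: y_def [symmetric] algebra_simps)
  qed
  \<comment> \<open>The sum of \<open>h / k\<close> is 0, so the terms of order
    \<open>n * ln n\<close> and those from \<open>- 1\<close> cancel. The sum of
    \<open>\<bar>h\<bar> + \<bar>g\<bar>\<close> is 100 and the sum of \<open>h\<close> is
    -23.\<close>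
  also have "\<dots> = 100 * ln (real n) - 23 -
      real n * (\<Sum>(k,h,g)\<leftarrow>weights. real_of_int h * ln (real_of_int k) / real_of_int k)"
    by (simp add: weights_def field_simps)
  finally show ?thesis by simp
qed

text \<open>The sum equals \<open>(396 ln 3 - 408 ln 2 - 45 ln 5) / 420\<close>.\<close>

lemma weights_entropy:
  "(\<Sum>(k,h,g)\<leftarrow>weights. real_of_int h * ln (real_of_int k) / real_of_int k) \<ge> 23 / 84 * ln 2"
proof -
  have ln: "ln 4 = 2 * ln (2::real)" "ln 6 = ln 2 + ln (3::real)" "ln 10 = ln 2 + ln (5::real)"
    "ln 12 = 2 * ln 2 + ln (3::real)" "ln 14 = ln 2 + ln (7::real)" "ln 21 = ln 3 + ln (7::real)"
    "ln 28 = 2 * ln 2 + ln (7::real)" "ln 42 = ln 2 + ln 3 + ln (7::real)"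
    "ln 70 = ln 2 + ln 5 + ln (7::real)" "ln 140 = 2 * ln 2 + ln 5 + ln (7::real)"
    "ln 210 = ln 2 + ln 3 + ln 5 + ln (7::real)"
    using ln_mult[of 2 "2::real"] ln_mult[of 2 "3::real"] ln_mult[of 2 "5::real"] ln_mult[of 4 "3::real"]
      ln_mult[of 2 "7::real"] ln_mult[of 3 "7::real"] ln_mult[of 4 "7::real"] ln_mult[of 6 "7::real"]
      ln_mult[of 10 "7::real"] ln_mult[of 20 "7::real"] ln_mult[of 4 "5::real"] ln_mult[of 30 "7::real"]
      ln_mult[of 6 "5::real"] by simp_all
  have "real a * ln 2 + real b * ln 5 \<le> real c * ln 3" if "(2::real) ^ a * 5 ^ b \<le> 3 ^ c" for a b c
  proof -
    from that have "ln ((2::real) ^ a * 5 ^ b) \<le> ln (3 ^ c)" by (subst ln_le_cancel_iff) auto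
    thus ?thesis by (simp add: ln_mult ln_realpow)
  qed
  \<comment> \<open>Since \<open>23 / 84 = 115 / 420\<close>, the coefficient of \<open>ln 2\<close>
    becomes \<open>408 + 115 = 523\<close>.\<close>
  from this[of 523 45 396] have "523 * ln 2 + 45 * ln (5::real) \<le> 396 * ln 3" by simp
  thus ?thesis by (simp add: weights_def ln add_divide_distrib diff_divide_distrib)
qed

lemma div_eq_2_natD:
  fixes n d :: nat
  assumes "n div d = 2"
  shows "2 * d \<le> n" "n < 3 * d"
proof -
  have "d > 0" using assms by (cases "d = 0") auto
  moreover have "n = 2 * d + n mod d" using assms div_mult_mod_eq[of n d] by simp
  ultimately show "2 * d \<le> n" "n < 3 * d" using mod_less_divisor[of d n] by linarith+
qed

text \<open>Only two kinds of prime powers \<open>d\<close> can have negative weight: those with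
  \<open>d \<le> n div 422\<close>, with deficit at most 9 and total controlled by Chebyshev's
  bound, and the proper prime powers in \<open>Q\<close>, with deficit at most 8 and number at most
  \<open>sqrt (n / 2)\<close>.\<close>

lemma weighted_sum_lower:
  assumes n: "n \<ge> 9"
    and no_prime: "\<And>p. prime p \<Longrightarrow> p mod 3 = 1 \<Longrightarrow> n div p \<noteq> 2"
  shows "- (18 / 422 * ln 2 * real n + 4 * sqrt (real n / 2) * ln (real n / 2)) \<le>
    (\<Sum>d=1..n. mangoldt d * (real_of_int (weight_H (int (n div d))) + chi3 d * real_of_int (weight_G (int (n div d)))))"
proof -
  define Q where "Q = {d \<in> {1..n}. n div d = 2 \<and> primepow d \<and> \<not> prime d}"
  define r where "r = sqrt (real n / 2)"
  define p where "p = (aprimedivisor :: nat \<Rightarrow> nat)"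
  \<comment> \<open>A proper prime power is at least the square of its prime, and
    \<open>d \<le> n / 2\<close>; hence \<open>p d \<le> r\<close>.\<close>
  have Q: "p d > 0 \<and> real (p d) \<le> r \<and> (\<exists>j. d = p d ^ j) \<and> mangoldt d = ln (p d) \<and> p d \<ge> 2" if "d \<in> Q" for d
  proof -
    from that have "primepow d" "\<not> prime d" "n div d = 2" "d > 0" by (auto simp: Q_def)
    then obtain q k where qk: "prime q" "d = q ^ k" "k > 0" by (auto simp: primepow_def)
    with \<open>\<not> prime d\<close> have "k \<ge> 2" by (cases "k = 1") auto
    have pd: "p d = q" using qk by (simp add: p_def aprimedivisor_prime_power)
    have "2 * d \<le> n" using \<open>n div d = 2\<close> by (rule div_eq_2_natD)
    moreover have "q ^ 2 \<le> d" unfolding qk(2) using \<open>k \<ge> 2\<close> qk(1)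
      by (intro power_increasing) (auto simp: prime_ge_Suc_0_nat)
    ultimately have "2 * q ^ 2 \<le> n" by linarith
    hence "real (2 * q ^ 2) \<le> real n" by (simp only: of_nat_le_iff)
    hence "2 * real q ^ 2 \<le> real n" by simp
    hence "real q \<le> r" unfolding r_def by (intro real_le_rsqrt) simp
    moreover have "mangoldt d = ln (real q)" using qk by simp
    ultimately show ?thesis using pd qk by (auto simp: prime_gt_0_nat prime_ge_2_nat)
  qed
  \<comment> \<open>Two powers of \<open>p\<close> differ by a factor of at least 2, so \<open>(n/3, n/2]\<close> contains at most one.\<close>
  have "inj_on p Q"
  proof (rule inj_onI, rule ccontr)
    have *: False if d: "d \<in> Q" "e \<in> Q" "p d = p e" "d < e" for d e
    proof -
      define q where "q = p d"
      from Q[OF d(1)] obtain i where i: "d = q ^ i" "q \<ge> 2" by (auto simp: q_def)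
      from Q[OF d(2)] d(3) obtain j where j: "e = q ^ j" by (auto simp: q_def)
      have "i < j" using d(4) i j by (metis linorder_not_le power_increasing order_trans one_le_numeral)
      hence "q ^ Suc i \<le> q ^ j" using i by (intro power_increasing) auto
      moreover have "2 * q ^ i \<le> q ^ Suc i" using i by simp
      ultimately have "2 * d \<le> e" using i(1) j by linarith
      moreover have "2 * e \<le> n" "n < 3 * d" using d(1,2) div_eq_2_natD[of n] by (auto simp: Q_def)
      ultimately show False by linarith
    qed
    fix d e assume "d \<in> Q" "e \<in> Q" "p d = p e" "d \<noteq> e"
    thus False using *[of d e] *[of e d] by (cases "d < e") auto
  qed
  moreover have "p ` Q \<subseteq> {1..nat \<lfloor>r\<rfloor>}"
    using Q by (fastforce simp: le_nat_floor Suc_le_eq)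
  ultimately have "card Q \<le> nat \<lfloor>r\<rfloor>"
    using card_inj_on_le[of p Q "{1..nat \<lfloor>r\<rfloor>}"] by simp
  hence cardQ: "real (card Q) \<le> r" by (simp add: r_def le_nat_iff le_floor_iff)
  have r: "r \<ge> 1" using n by (simp add: r_def)
  have "(\<Sum>d\<in>Q. mangoldt d) \<le> (\<Sum>d\<in>Q. ln r)"
    using Q r by (intro sum_mono) auto
  also have "\<dots> \<le> r * ln r" using cardQ r by (simp add: mult_right_mono)
  also have "ln r = ln (real n / 2) / 2" using n by (simp add: r_def ln_sqrt)
  finally have SQ: "(\<Sum>d\<in>Q. mangoldt d) \<le> r * ln (real n / 2) / 2" by simp

  have "(\<Sum>d=1..n div 422. mangoldt d) \<le> real (n div 422) * (2 * ln 2)"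
    by (rule sum_mangoldt_le)
  also have "\<dots> \<le> (real n / 422) * (2 * ln 2)"
    using of_nat_div_le_of_nat[of n 422, where ?'a = real] by (intro mult_right_mono) auto
  finally have ST: "(\<Sum>d=1..n div 422. mangoldt d) \<le> real n / 211 * ln 2" by simp

  have "- (9 * (\<Sum>d=1..n div 422. mangoldt d) + 8 * (\<Sum>d\<in>Q. mangoldt d) :: real) =
      (\<Sum>d=1..n. - (9 * (if d \<le> n div 422 then mangoldt d else 0) + 8 * (if d \<in> Q then mangoldt d else 0)))"
  proof -
    have "(\<Sum>d=1..n div 422. mangoldt d) = (\<Sum>d=1..n. if d \<le> n div 422 then mangoldt d else 0 :: real)"
      by (rule sum.mono_neutral_cong_left) auto
    moreover have "(\<Sum>d\<in>Q. mangoldt d) = (\<Sum>d=1..n. if d \<in> Q then mangoldt d else 0 :: real)"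
      by (rule sum.mono_neutral_cong_left) (auto simp: Q_def)
    ultimately show ?thesis by (simp only: sum_negf sum.distrib flip: sum_distrib_left)
  qed
  also have "\<dots> \<le> (\<Sum>d=1..n. mangoldt d * (real_of_int (weight_H (int (n div d))) + chi3 d * real_of_int (weight_G (int (n div d)))))"
  proof (intro sum_mono)
    fix d assume d: "d \<in> {1..n}"
    define u where "u = n div d"
    define c :: real where "c = 9 * (if d \<le> n div 422 then 1 else 0) + 8 * (if d \<in> Q then 1 else 0)"
    have u: "u \<ge> 1" using d by (auto simp: u_def div_greater_zero_iff Suc_le_eq)
    have u422: "u \<ge> 422 \<longleftrightarrow> d \<le> n div 422" unfolding u_def
      using d by (simp add: less_eq_div_iff_mult_less_eq mult.commute)
    have c: "- c \<le> real_of_int (weight_H (int u)) + chi3 d * real_of_int (weight_G (int u))" if "primepow d"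
    proof -
      have G: "real_of_int \<bar>weight_G (int u)\<bar> \<le> real_of_int (weight_H (int u) + (if int u = 2 then 8 else if int u \<ge> 422 then 9 else 0))"
        using abs_weight_G_le[of "int u"] u by (simp only: of_int_le_iff)
      have chi3: "chi3 d = 1 \<or> chi3 d = -1 \<or> chi3 d = 0" by (auto simp: chi3_def)
      show ?thesis
      proof (cases "u = 2 \<and> d \<notin> Q")
        case False
        have "(if int u = 2 then 8 else if int u \<ge> 422 then 9 else 0) \<le> c"
          using False u422 by (auto simp: c_def)
        thus ?thesis using G chi3 by (auto simp: abs_if split: if_splits)
      next
        case True
        hence "prime d" using that d by (auto simp: Q_def u_def)
        moreover have "\<not> 3 dvd d"
        proof
          assume "3 dvd d"
          with \<open>prime d\<close> have "d = 3" using primes_dvd_imp_eq[of 3 d] by auto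
          with True have "n div 3 = 2" by (simp add: u_def)
          with n show False using div_eq_2_natD(2) by fastforce
        qed
        ultimately have "d mod 3 = 2"
          using no_prime[of d] True unfolding u_def dvd_eq_mod_eq_0 by linarith
        hence "chi3 d = -1" by (simp add: chi3_def)
        \<comment> \<open>A prime that is 2 modulo 3 has twist -1, so its weight is
          \<open>-4 - (-4) = 0\<close>.\<close>
        moreover have "weight_H 2 = -4" "weight_G 2 = -4" by (simp_all add: weight_H_def weight_G_def weights_def)
        ultimately show ?thesis using True by (simp add: c_def)
      qed
    qed
    have "mangoldt d * - c \<le> mangoldt d * (real_of_int (weight_H (int u)) + chi3 d * real_of_int (weight_G (int u)))"
    proof (cases "primepow d")
      case True
      thus ?thesis using c by (intro mult_left_mono mangoldt_nonneg) auto
    qed (simp add: mangoldt_def)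
    thus "- (9 * (if d \<le> n div 422 then mangoldt d else 0) + 8 * (if d \<in> Q then mangoldt d else 0)) \<le>
       mangoldt d * (real_of_int (weight_H (int (n div d))) + chi3 d * real_of_int (weight_G (int (n div d))))"
      by (auto simp: c_def u_def algebra_simps split: if_splits)
  qed
  finally show ?thesis using SQ ST unfolding r_def by argo
qed

text \<open>If there were no such prime, the two bounds would put a positive multiple of
  \<open>s ^ 2\<close>, where \<open>s = sqrt n\<close>, below terms of order
  \<open>s * ln s\<close>; this fails for \<open>s \<ge> 500\<close>.\<close>

lemma prime_1_mod_3_large:
  fixes n :: nat
  assumes n: "n \<ge> 300000"
  shows "\<exists>p. prime p \<and> p mod 3 = 1 \<and> n div p = 2"
proof (rule ccontr)
  assume "\<not> ?thesis"
  hence no: "\<And>p. prime p \<Longrightarrow> p mod 3 = 1 \<Longrightarrow> n div p \<noteq> 2" by blast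
  define s where "s = sqrt (real n)"
  have s2: "real n = s ^ 2" by (simp add: s_def)
  have s: "s \<ge> 500" unfolding s_def using n by (intro real_le_rsqrt) simp
  have lnn: "ln (real n) = 2 * ln s" unfolding s2 using s by (simp add: ln_realpow)
  have "244 \<le> (5/2 :: real) ^ 6" by (simp add: power_numeral_reduce)
  also have "\<dots> \<le> exp 1 ^ 6"
    using exp_lower_Taylor_quadratic[of 1] by (intro power_mono) auto
  also have "\<dots> = exp 6" by (simp flip: exp_of_nat_mult)
  finally have e6: "244 \<le> exp (6::real)" .
  \<comment> \<open>The tangent of \<open>ln\<close> at \<open>exp 6\<close> gives
    \<open>ln s \<le> s / exp 6 + 5\<close>; the estimate \<open>exp 1 \<ge> 5 / 2\<close> bounds
    \<open>exp 6\<close> below by 244.\<close>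
  have "ln s = ln (s / exp 6) + 6" using s by (simp add: ln_div)
  also have "ln (s / exp 6) \<le> s / exp 6 - 1" using s by (intro ln_le_minus_one) auto
  also have "s / exp 6 \<le> s / 244" using e6 s by (intro divide_left_mono) auto
  finally have lns: "ln s \<le> s / 244 + 5" by simp
  have ln2: "ln 2 \<ge> (1/2 :: real)"
  proof -
    have "exp (1/2) ^ 2 = exp (1 :: real)" by (simp flip: exp_of_nat_mult)
    also have "\<dots> \<le> 3" by (rule exp_le)
    also have "\<dots> \<le> (2 :: real) ^ 2" by simp
    finally have "exp (1/2 :: real) \<le> 2" by (rule power2_le_imp_le) simp
    thus ?thesis by (subst ln_ge_iff) auto
  qed
  \<comment> \<open>The fraction \<open>5 / 7\<close> is a rational number just above
    \<open>1 / sqrt 2\<close>.\<close>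
  have "sqrt (real n / 2) \<le> 5 / 7 * s" unfolding s2
    using s by (intro real_le_lsqrt) (auto simp: power2_eq_square)
  moreover have "0 \<le> ln (real n / 2)" "ln (real n / 2) \<le> 2 * ln s"
    using n by (auto simp flip: lnn)
  ultimately have "sqrt (real n / 2) * ln (real n / 2) \<le> (5 / 7 * s) * (2 * ln s)"
    using s by (intro mult_mono) auto
  hence sq: "4 * sqrt (real n / 2) * ln (real n / 2) \<le> 40 / 7 * (s * ln s)" by simp
  have "real n * (23 / 84 * ln 2) \<le>
      real n * (\<Sum>(k,h,g)\<leftarrow>weights. real_of_int h * ln (real_of_int k) / real_of_int k)"
    by (intro mult_left_mono weights_entropy) auto
  also have "\<dots> \<le> 100 * ln (real n) + (18 / 422 * ln 2 * real n + 4 * sqrt (real n / 2) * ln (real n / 2))"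
    using order_trans[OF weighted_sum_lower[OF _ no] weighted_sum_upper] n by fastforce
  also have "\<dots> \<le> 200 * ln s + (18 / 422 * ln 2 * real n + 40 / 7 * (s * ln s))"
    using sq lnn by simp
  finally have "real n * (23 / 84 * ln 2) - 18 / 422 * ln 2 * real n \<le> (40 / 7 * s + 200) * ln s"
    by (simp add: algebra_simps)
  also have "\<dots> \<le> (40 / 7 * s + 200) * (s / 244 + 5)"
    using s lns by (intro mult_left_mono) auto
  finally have "ln 2 * (s\<^sup>2 * (23 / 84 - 18 / 422)) \<le> (40 / 7 * s + 200) * (s / 244 + 5)"
    unfolding s2 by (simp add: algebra_simps)
  moreover have "1 / 2 * (s\<^sup>2 * (23 / 84 - 18 / 422)) \<le> ln 2 * (s\<^sup>2 * (23 / 84 - 18 / 422))"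
    using ln2 by (intro mult_right_mono) auto
  moreover have "500 * s \<le> s\<^sup>2" using s by (simp add: power2_eq_square)
  moreover have "(40 / 7 * s + 200) * (s / 244 + 5) = 10 / 427 * s\<^sup>2 + 12550 / 427 * s + 1000"
    by (simp add: power2_eq_square field_simps)
  ultimately show False using s by argo
qed

section \<open>Explicit primes for the range below 300000\<close>

lemma not_prime_sqrt:
  fixes p :: nat
  assumes "\<not> prime p" "1 < p"
  obtains d where "prime d" "d dvd p" "d * d \<le> p"
proof -
  from assms obtain q where q: "prime q" "q dvd p" using prime_factor_nat[of p] by auto
  then obtain r where r: "p = q * r" by (auto elim: dvdE)
  hence "r > 1" using assms q by (cases "r = 0 \<or> r = 1") auto
  then obtain t where t: "prime t" "t dvd r" using prime_factor_nat[of r] by auto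
  show ?thesis
  proof (cases "q \<le> r")
    case True
    thus ?thesis using that[of q] q r by simp
  next
    case False
    have "t \<le> r" using t \<open>r > 1\<close> by (auto intro: dvd_imp_le)
    hence "t * t \<le> q * r" using False by (intro mult_mono) auto
    thus ?thesis using that[of t] t r by simp
  qed
qed

text \<open>Trial division, phrased with \<open>int\<close> and \<open>list_all\<close> so that
  \<open>code_simp\<close> can evaluate the hypotheses.\<close>

lemma prime_nat_trial:
  fixes p k :: int
  assumes "1 < p" "0 < k" "p < k * k" "list_all (\<lambda>d. p mod d \<noteq> 0) [2..k]"
  shows "prime (nat p)"
proof (rule ccontr)
  assume "\<not> prime (nat p)"
  then obtain d where d: "prime d" "d dvd nat p" "d * d \<le> nat p"
    by (rule not_prime_sqrt) (use assms(1) in auto)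
  have "int d dvd p" using d(2) assms(1) by (simp add: int_dvd_int_iff [symmetric])
  hence "p mod int d = 0" by simp
  hence "\<not> (int d \<in> set [2..k])" using assms(4) by (auto simp: list_all_iff simp del: set_upto)
  hence "k < int d" using prime_ge_2_nat[OF d(1)] by simp
  moreover have "int d * int d \<le> p" using d(3) assms(1) by (simp add: le_nat_iff)
  ultimately show False using assms mult_strict_mono[of k "int d" k "int d"]
    by (auto simp: not_le)
qed

text \<open>Twice each prime is at most three times its predecessor, so the intervals
  \<open>[2p, 3p)\<close> cover everything from 62 to 436376.\<close>

lemma sparse_primes:
  "\<forall>p::nat \<in> {31, 43, 61, 79, 109, 163, 241, 349, 523, 769, 1153, 1723,
      2557, 3823, 5701, 8539, 12799, 19183, 28771, 43117, 64663, 96979, 145459}.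
     prime p \<and> p mod 3 = 1"
proof -
  have "prime (nat 31)" by (rule prime_nat_trial[of _ 6]) code_simp+
  moreover have "prime (nat 43)" by (rule prime_nat_trial[of _ 7]) code_simp+
  moreover have "prime (nat 61)" by (rule prime_nat_trial[of _ 8]) code_simp+
  moreover have "prime (nat 79)" by (rule prime_nat_trial[of _ 9]) code_simp+
  moreover have "prime (nat 109)" by (rule prime_nat_trial[of _ 11]) code_simp+
  moreover have "prime (nat 163)" by (rule prime_nat_trial[of _ 13]) code_simp+
  moreover have "prime (nat 241)" by (rule prime_nat_trial[of _ 16]) code_simp+
  moreover have "prime (nat 349)" by (rule prime_nat_trial[of _ 19]) code_simp+
  moreover have "prime (nat 523)" by (rule prime_nat_trial[of _ 23]) code_simp+
  moreover have "prime (nat 769)" by (rule prime_nat_trial[of _ 28]) code_simp+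
  moreover have "prime (nat 1153)" by (rule prime_nat_trial[of _ 34]) code_simp+
  moreover have "prime (nat 1723)" by (rule prime_nat_trial[of _ 42]) code_simp+
  moreover have "prime (nat 2557)" by (rule prime_nat_trial[of _ 51]) code_simp+
  moreover have "prime (nat 3823)" by (rule prime_nat_trial[of _ 62]) code_simp+
  moreover have "prime (nat 5701)" by (rule prime_nat_trial[of _ 76]) code_simp+
  moreover have "prime (nat 8539)" by (rule prime_nat_trial[of _ 93]) code_simp+
  moreover have "prime (nat 12799)" by (rule prime_nat_trial[of _ 114]) code_simp+
  moreover have "prime (nat 19183)" by (rule prime_nat_trial[of _ 139]) code_simp+
  moreover have "prime (nat 28771)" by (rule prime_nat_trial[of _ 170]) code_simp+
  moreover have "prime (nat 43117)" by (rule prime_nat_trial[of _ 208]) code_simp+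
  moreover have "prime (nat 64663)" by (rule prime_nat_trial[of _ 255]) code_simp+
  moreover have "prime (nat 96979)" by (rule prime_nat_trial[of _ 312]) code_simp+
  moreover have "prime (nat 145459)" by (rule prime_nat_trial[of _ 382]) code_simp+
  ultimately show ?thesis
    by (simp del: prime_nat_numeral_eq)
qed

lemma prime_1_mod_3_between:
  fixes n :: nat
  assumes "n \<ge> 62"
  shows "\<exists>p. prime p \<and> p mod 3 = 1 \<and> n < 3 * p \<and> 2 * p \<le> n"
proof (cases "n \<ge> 300000")
  case True
  then obtain p where "prime p" "p mod 3 = 1" "n div p = 2" using prime_1_mod_3_large by blast
  moreover from this have "n < 3 * p" "2 * p \<le> n" using div_eq_2_natD[of n p] by auto
  ultimately show ?thesis by blast
next
  case False
  show ?thesis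
  proof (rule ccontr)
    assume none: "\<not> ?thesis"
    have step: "3 * p \<le> n" if "2 * p \<le> n"
      "p \<in> {31, 43, 61, 79, 109, 163, 241, 349, 523, 769, 1153, 1723,
      2557, 3823, 5701, 8539, 12799, 19183, 28771, 43117, 64663, 96979, 145459}" for p
      using none that sparse_primes by (meson not_le)
    have "93 \<le> n" using step[of 31] assms by simp
    hence "129 \<le> n" using step[of 43] by simp
    hence "183 \<le> n" using step[of 61] by simp
    hence "237 \<le> n" using step[of 79] by simp
    hence "327 \<le> n" using step[of 109] by simp
    hence "489 \<le> n" using step[of 163] by simp
    hence "723 \<le> n" using step[of 241] by simp
    hence "1047 \<le> n" using step[of 349] by simp
    hence "1569 \<le> n" using step[of 523] by simp
    hence "2307 \<le> n" using step[of 769] by simp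
    hence "3459 \<le> n" using step[of 1153] by simp
    hence "5169 \<le> n" using step[of 1723] by simp
    hence "7671 \<le> n" using step[of 2557] by simp
    hence "11469 \<le> n" using step[of 3823] by simp
    hence "17103 \<le> n" using step[of 5701] by simp
    hence "25617 \<le> n" using step[of 8539] by simp
    hence "38397 \<le> n" using step[of 12799] by simp
    hence "57549 \<le> n" using step[of 19183] by simp
    hence "86313 \<le> n" using step[of 28771] by simp
    hence "129351 \<le> n" using step[of 43117] by simp
    hence "193989 \<le> n" using step[of 64663] by simp
    hence "290937 \<le> n" using step[of 96979] by simp
    hence "436377 \<le> n" using step[of 145459] by simp
    thus False using False by simp
  qed
qed

section \<open>Valuations of totients\<close>

text \<open>Read off from the product of \<open>q ^ (e - 1) * (q - 1)\<close> over the primes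
  \<open>q\<close> of \<open>y\<close>. Truncated subtraction makes the first term 0 when
  \<open>p\<close> does not divide \<open>y\<close>.\<close>

lemma multiplicity_totient:
  fixes p y :: nat
  assumes p: "prime p" and y: "y > 0"
  shows "multiplicity p (totient y) =
    multiplicity p y - 1 + (\<Sum>q\<in>prime_factors y. multiplicity p (q - 1))"
proof -
  have pe: "prime_elem p" using p by simp
  have "multiplicity p (totient y) =
      (\<Sum>q\<in>prime_factors y. multiplicity p (q ^ (multiplicity q y - 1) * (q - 1)))"
    unfolding totient_formula1[OF y] using pe
    by (subst prime_elem_multiplicity_prod_distrib) (auto dest!: in_prime_factors_imp_prime simp: prime_nat_iff)
  also have "\<dots> = (\<Sum>q\<in>prime_factors y. (if q = p then multiplicity p y - 1 else 0) + multiplicity p (q - 1))"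
  proof (intro sum.cong refl)
    fix q assume "q \<in> prime_factors y"
    hence q: "prime q" by auto
    hence "q - 1 \<noteq> 0" "q \<noteq> 0" using prime_gt_1_nat[OF q] by auto
    moreover have "multiplicity p (q ^ k) = (if q = p then k else 0)" for k
      using p q by (auto simp: multiplicity_same_power multiplicity_prime_power multiplicity_distinct_prime_power)
    ultimately show "multiplicity p (q ^ (multiplicity q y - 1) * (q - 1)) =
        (if q = p then multiplicity p y - 1 else 0) + multiplicity p (q - 1)"
      using pe by (auto simp: prime_elem_multiplicity_mult_distrib)
  qed
  also have "\<dots> = multiplicity p y - 1 + (\<Sum>q\<in>prime_factors y. multiplicity p (q - 1))"
    using p y by (auto simp: sum.distrib prime_factors_dvd not_dvd_imp_multiplicity_0)
  finally show ?thesis .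
qed

lemma multiplicity_totient_eq:
  fixes p y :: nat
  assumes "prime p" "y > 0" and no: "\<And>q. prime q \<Longrightarrow> q dvd y \<Longrightarrow> \<not> p dvd q - 1"
  shows "multiplicity p (totient y) = multiplicity p y - 1"
proof -
  have "(\<Sum>q\<in>prime_factors y. multiplicity p (q - 1)) = 0"
    using no by (intro sum.neutral) (auto simp: in_prime_factors_iff not_dvd_imp_multiplicity_0)
  thus ?thesis using multiplicity_totient[OF assms(1,2)] by simp
qed

text \<open>The multiples of \<open>p\<close> up to \<open>n\<close> are
  \<open>p, ..., k * p\<close>, and \<open>k < p\<close> keeps \<open>p ^ 2\<close> from dividing
  any of them.\<close>

lemma multiplicity_fact:
  fixes p n k :: nat
  assumes p: "prime p" and "k < p" "k * p \<le> n" "n < Suc k * p"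
  shows "multiplicity p (fact n) = k"
  using assms(2-)
proof (induction n arbitrary: k)
  case 0
  thus ?case by simp
next
  case (Suc n)
  have dist: "multiplicity p (fact (Suc n)) = multiplicity p (Suc n) + multiplicity p (fact n)"
    unfolding fact_Suc of_nat_id using p by (subst prime_elem_multiplicity_mult_distrib) auto
  show ?case
  proof (cases "Suc n = k * p")
    case True
    with Suc.prems p have k: "k > 0" by (auto intro: Nat.gr0I)
    have "(k - 1) * p \<le> n" "n < k * p" using True k prime_gt_0_nat[OF p] by (auto simp: diff_mult_distrib)
    hence "multiplicity p (fact n) = k - 1" using Suc.prems k by (intro Suc.IH) auto
    moreover have "\<not> p dvd k" using Suc.prems k by (auto dest: dvd_imp_le)
    hence "multiplicity p (Suc n) = 1" unfolding True using p k
      by (simp add: prime_elem_multiplicity_mult_distrib not_dvd_imp_multiplicity_0 multiplicity_self)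
    ultimately show ?thesis using dist k by simp
  next
    case False
    have "\<not> p dvd Suc n"
    proof
      assume "p dvd Suc n"
      then obtain c where c: "Suc n = c * p" by (metis dvd_def mult.commute)
      with False Suc.prems have "k * p < c * p" "c * p < Suc k * p" by linarith+
      hence "k < c" "c < Suc k" by (simp_all only: mult_less_cancel2)
      thus False by simp
    qed
    moreover have "multiplicity p (fact n) = k" using False Suc.prems by (intro Suc.IH) auto
    ultimately show ?thesis using dist by (simp add: not_dvd_imp_multiplicity_0)
  qed
qed

text \<open>The only candidate is \<open>q = p + 1\<close>, which is even and larger than 2.\<close>

lemma no_prime_1_mod_upper_half:
  fixes p q n :: nat
  assumes "prime p" "p > 2" "n < 2 * p" "prime q" "q \<le> n"
  shows "\<not> p dvd q - 1"
proof
  assume "p dvd q - 1"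
  then obtain c where c: "q - 1 = p * c" by (auto elim: dvdE)
  with prime_gt_1_nat[OF assms(4)] have q: "q = p * c + 1" "c \<noteq> 0"
    by (linarith, intro notI, simp)
  with assms have "p * c < p * 2" by linarith
  hence "c = 1" using q by simp
  moreover have "odd p" using assms(1,2) by (simp add: prime_odd_nat)
  ultimately have "even q" "q > 2" using q assms(2) by auto
  thus False using assms(4) prime_odd_nat by blast
qed

text \<open>The candidates are \<open>p + 1\<close>, which is even, and \<open>2 * p + 1\<close>,
  which the fourth hypothesis excludes.\<close>

lemma no_prime_1_mod_middle:
  fixes p q n :: nat
  assumes "prime p" "p > 2" "n < 3 * p" "\<not> prime (2 * p + 1) \<or> n < 2 * p + 1" "prime q" "q \<le> n"
  shows "\<not> p dvd q - 1"
proof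
  assume "p dvd q - 1"
  then obtain c where c: "q - 1 = p * c" by (auto elim: dvdE)
  with prime_gt_1_nat[OF assms(5)] have q: "q = p * c + 1" "c \<noteq> 0"
    by (linarith, intro notI, simp)
  with assms have "p * c < p * 3" by linarith
  hence "c = 1 \<or> c = 2" using q by auto
  thus False
  proof
    assume "c = 1"
    moreover have "odd p" using assms(1,2) by (simp add: prime_odd_nat)
    ultimately have "even q" "q > 2" using q assms(2) by auto
    thus False using assms(5) prime_odd_nat by blast
  next
    assume "c = 2"
    hence "q = 2 * p + 1" using q by simp
    thus False using assms(4,5,6) by auto
  qed
qed

section \<open>The bound on n\<close>

lemma totient_power_equation_bound:
  fixes a b c m x n :: nat
  assumes pos: "a > 0" "b > 0" "c > 0" "m \<ge> 2" "x > 0"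
    and eq: "c * totient (a * x ^ m) = b * fact n"
    and mid: "\<And>N. N \<ge> 62 \<Longrightarrow> \<exists>p. prime p \<and> p mod 3 = 1 \<and> N < 3 * p \<and> 2 * p \<le> (N :: nat)"
  shows "n \<le> Max {61, 3 * a, 3 * b, 3 * c}"
proof (rule ccontr)
  assume "\<not> ?thesis"
  hence n: "n \<ge> 62" "3 * a < n" "3 * b < n" "3 * c < n" by (auto simp: not_le)
  define y where "y = a * x ^ m"
  have y: "y > 0" using pos by (simp add: y_def)
  \<comment> \<open>A prime of \<open>y\<close> that does not divide \<open>a\<close> divides
    \<open>x\<close>, so its square divides \<open>y\<close> because \<open>m \<ge> 2\<close>. Hence
    it divides \<open>totient y\<close> and so \<open>b * fact n\<close>.\<close>
  have le: "q \<le> n" if q: "prime q" "q dvd y" for q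
  proof (cases "q dvd a")
    case True
    thus ?thesis using n pos dvd_imp_le[of q a] by linarith
  next
    case False
    hence "q dvd x" using q prime_dvd_power by (auto simp: y_def prime_dvd_mult_iff)
    hence "q ^ 2 dvd x ^ m" using pos(4) by (meson dvd_power_same dvd_trans le_imp_power_dvd)
    hence "totient (q ^ 2) dvd totient y" by (intro totient_dvd) (simp add: y_def)
    moreover have "totient (q ^ 2) = q * (q - 1)"
      using totient_prime_power[OF q(1), of 2] by simp
    ultimately have "q dvd totient y" by (metis dvd_mult_left)
    hence "q dvd b * fact n" by (metis eq y_def dvd_mult)
    hence "q dvd b \<or> q \<le> n" using q(1) by (simp add: prime_dvd_mult_iff prime_dvd_fact_iff)
    thus ?thesis using n pos dvd_imp_le[of q b] by linarith
  qed
  \<comment> \<open>As \<open>3 * p > n\<close>, the prime \<open>p\<close> exceeds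
    \<open>a\<close>, \<open>b\<close> and \<open>c\<close>, so none of them affects the exponent.
    This explains the factors 3 in the bound.\<close>
  have val: "m * multiplicity p x - 1 = multiplicity p (fact n)"
    if p: "prime p" "n < 3 * p" and no: "\<And>q. prime q \<Longrightarrow> q \<le> n \<Longrightarrow> \<not> p dvd q - 1" for p
  proof -
    have nd: "multiplicity p d = 0" if "d > 0" "3 * d < n" for d
      using that p dvd_imp_le[of p d] by (intro not_dvd_imp_multiplicity_0) auto
    have "multiplicity p y - 1 = multiplicity p (totient y)"
      using multiplicity_totient_eq[OF p(1) y] no le by metis
    also have "\<dots> = multiplicity p (c * totient y)"
      using p nd[of c] pos n y by (simp add: prime_elem_multiplicity_mult_distrib)
    also have "\<dots> = multiplicity p (fact n)"
      using p nd[of b] pos n eq by (simp add: y_def prime_elem_multiplicity_mult_distrib)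
    finally show ?thesis
      using p nd[of a] pos n by (simp add: y_def prime_elem_multiplicity_mult_distrib prime_elem_multiplicity_power_distrib)
  qed
  \<comment> \<open>Applied to \<open>2 * n\<close>, \<open>mid\<close> yields a prime in
    \<open>(2n/3, n]\<close>, inside the upper half.\<close>
  obtain p where p: "prime p" "2 * n < 3 * p" "p \<le> n" using mid[of "2 * n"] n by auto
  have "m * multiplicity p x - 1 = 1"
    using val[of p] no_prime_1_mod_upper_half[of p n] multiplicity_fact[of p 1 n] p n by auto
  hence "m * multiplicity p x = 2" by linarith
  hence "m dvd 2" by (metis dvd_triv_left)
  hence m: "m = 2" using pos(4) dvd_imp_le[of m 2] by simp
  obtain p where p: "prime p" "p mod 3 = 1" "n < 3 * p" "2 * p \<le> n" using mid[of n] n by auto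
  have "3 dvd 2 * p + 1" "2 * p + 1 > 3" using p(2,3) n(1) by (presburger, linarith)
  hence "\<not> prime (2 * p + 1)" using primes_dvd_imp_eq[of 3 "2 * p + 1"] by auto
  hence "m * multiplicity p x - 1 = 2"
    using val[of p] no_prime_1_mod_middle[of p n] multiplicity_fact[of p 2 n] p n by auto
  \<comment> \<open>The left side \<open>2 * e - 1\<close> is odd, or 0 by truncation, hence never
    2.\<close>
  thus False unfolding m by presburger
qed

text \<open>Bounds \<open>x\<close> once \<open>n\<close> is bounded, which gives
  finiteness.\<close>

lemma le_totient_power:
  fixes a x m :: nat
  assumes "a > 0" "x > 0" "m \<ge> 2"
  shows "x \<le> totient (a * x ^ m)"
proof -
  have "x \<le> x ^ (m - 1)" using assms by (intro self_le_power) auto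
  also have "\<dots> \<le> x ^ (m - 1) * totient x" using assms by (simp add: Suc_le_eq)
  also have "\<dots> = totient (x ^ m)" using assms by (simp add: totient_power)
  also have "\<dots> \<le> totient (a * x ^ m)" using assms by (intro totient_dvd_mono) auto
  finally show ?thesis .
qed

section \<open>The equation with a factorial\<close>

text \<open>
  The list holds the candidate prime divisors in decreasing order. If \<open>p\<^sup>2\<close> divides \<open>N\<close> but \<open>p\<close> does not
  divide \<open>N / p\<^sup>2\<close>, the exponent of \<open>p\<close> in \<open>N\<close> is even and there is no solution.
\<close>

function mult_totient_inv :: "nat list \<Rightarrow> nat \<Rightarrow> nat option" where
  "mult_totient_inv [] N = (if N = 1 then Some 1 else None)"
| "mult_totient_inv (p # ps) N =
     (if p \<le> 1 \<or> N = 0 then None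
      else if p ^ 2 dvd N then
        (if p dvd N div p ^ 2 then map_option ((*) p) (mult_totient_inv (p # ps) (N div p ^ 2)) else None)
      else if p dvd N then
        (if p * (p - 1) dvd N then map_option ((*) p) (mult_totient_inv ps (N div (p * (p - 1)))) else None)
      else mult_totient_inv ps N)"
  by pat_completeness auto
termination
  by (relation "inv_image (less_than <*lex*> less_than) (\<lambda>(ps, N). (length ps, N))")
     (auto simp: power2_eq_square intro!: div_less_dividend one_less_mult)

declare mult_totient_inv.simps(2) [simp del]

text \<open>Splits off the \<open>p\<close>-part. When \<open>p\<close> exceeds all primes of
  \<open>w\<close>, the exponent of \<open>p\<close> on the right is exactly the odd number
  \<open>2 * k - 1\<close>.\<close>

lemma mult_totient_mult_eq:
  assumes "x = p ^ k * w" "k > 0" "prime p" "\<not> p dvd w"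
  shows "x * totient x = p ^ (2 * k - 1) * (p - 1) * (w * totient w)"
proof -
  have "coprime (p ^ k) w" using assms by (simp add: prime_imp_coprime)
  hence "x * totient x = p ^ k * w * (p ^ (k - 1) * (p - 1) * totient w)"
    using assms by (simp add: totient_mult_coprime totient_prime_power)
  also have "p ^ (2 * k - 1) = p ^ k * p ^ (k - 1)"
    using assms(2) by (simp flip: power_add add: mult_2)
  ultimately show ?thesis by (simp add: mult_ac)
qed

text \<open>The head \<open>p\<close> is the largest candidate, so it divides no
  \<open>q - 1\<close> for a prime \<open>q\<close> of \<open>x\<close>, and \<open>N\<close> shows
  the exponent \<open>k\<close> of \<open>p\<close> in \<open>x\<close>. A result
  \<open>None\<close> thus excludes every solution, and \<open>Some x\<close> leaves a single
  one.\<close>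

lemma mult_totient_inv_correct:
  fixes x :: nat
  assumes "x > 0" "x * totient x = N" "\<forall>q. prime q \<longrightarrow> q dvd x \<longrightarrow> q \<in> set ps"
    "sorted_wrt (>) ps" "\<forall>q\<in>set ps. prime q"
  shows "mult_totient_inv ps N = Some x"
  using assms
proof (induction ps N arbitrary: x rule: mult_totient_inv.induct)
  case (1 N)
  have "x = 1" using prime_factor_nat[of x] 1 by auto
  thus ?case using 1 by simp
next
  case (2 p ps N)
  have p: "prime p" using 2 by simp
  have N: "N > 0" using 2 by auto
  define k where "k = multiplicity p x"
  obtain w where w: "x = p ^ k * w" "\<not> p dvd w"
  proof -
    have "x \<noteq> 0" "\<not> is_unit p" using p 2(4) by (auto simp: prime_nat_iff)
    from multiplicity_decompose'[OF this] that show thesis unfolding k_def by blast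
  qed
  have wpos: "w > 0" using w(2) by (auto intro: Nat.gr0I)
  have nd: "\<not> p dvd totient w"
  proof -
    have "\<not> p dvd q - 1" if "prime q" "q dvd w" for q
    proof -
      have "q dvd x" using that w by simp
      hence "q \<in> set (p # ps)" using 2(6) that by blast
      hence "q \<le> p" using 2(7) by auto
      thus ?thesis using prime_gt_1_nat[OF that(1)] by (auto dest: dvd_imp_le)
    qed
    hence "multiplicity p (totient w) = 0"
      using multiplicity_totient_eq[OF p wpos] w(2) by (simp add: not_dvd_imp_multiplicity_0)
    thus ?thesis using prime_elem_multiplicity_eq_zero_iff[of p "totient w"] p wpos by simp
  qed
  have ndp: "\<not> p dvd p - 1" using prime_gt_1_nat[OF p] by (auto dest: dvd_imp_le)
  have wps: "\<forall>q. prime q \<longrightarrow> q dvd w \<longrightarrow> q \<in> set ps"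
  proof (intro allI impI)
    fix q assume q: "prime q" "q dvd w"
    hence "q dvd x" using w(1) by simp
    hence "q \<in> set (p # ps)" using 2(6) q(1) by blast
    thus "q \<in> set ps" using q(2) w(2) by auto
  qed
  have ps: "sorted_wrt (>) ps" "\<forall>q\<in>set ps. prime q" using 2(7,8) by auto
  have g: "\<not> (p \<le> 1 \<or> N = 0)" using N prime_gt_1_nat[OF p] by simp
  show ?case
  proof (cases "k = 0")
    case True
    hence "x = w" using w by simp
    hence "\<not> p dvd N" using 2(5) p w nd by (auto simp: prime_dvd_mult_iff)
    moreover from this have "\<not> p ^ 2 dvd N" by (auto dest: dvd_mult_left simp: power2_eq_square)
    moreover have "mult_totient_inv ps N = Some x"
      using 2(3)[OF g] calculation 2(4,5) wps ps \<open>x = w\<close> by blast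
    ultimately show ?thesis using g by (simp add: mult_totient_inv.simps(2)[of p ps N])
  next
    case False
    define M where "M = (p - 1) * (w * totient w)"
    have M: "\<not> p dvd M" using p ndp nd w by (auto simp: M_def prime_dvd_mult_iff)
    have NM: "N = p ^ (2 * k - 1) * M"
      using mult_totient_mult_eq[OF w(1) _ p w(2)] False 2(5) by (simp add: M_def)
    show ?thesis
    proof (cases "k = 1")
      case True
      have NM: "N = p * (p - 1) * (w * totient w)" using NM True by (simp add: M_def)
      have a: "\<not> p ^ 2 dvd N"
        using M p unfolding NM power2_eq_square by (simp add: M_def mult.assoc)
      have b: "p dvd N" "p * (p - 1) dvd N" "N div (p * (p - 1)) = w * totient w"
        using NM prime_gt_1_nat[OF p] by (auto simp: mult.assoc)
      have "mult_totient_inv ps (N div (p * (p - 1))) = Some w"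
        by (rule 2(2)[OF g a b(1,2) wpos b(3)[symmetric] wps ps])
      thus ?thesis using g w True a b by (simp add: mult_totient_inv.simps(2)[of p ps N])
    next
      case kF: False
      \<comment> \<open>For \<open>k \<ge> 2\<close> one factor \<open>p\<close> is taken from
        \<open>x\<close>: this divides \<open>N\<close> by \<open>p ^ 2\<close> and leaves the
        exponent \<open>2 * j + 1\<close>, so \<open>p\<close> stays at the head.\<close>
      define j where "j = k - 2"
      have k: "k = j + 2" using False kF by (simp add: j_def)
      have N': "N = p ^ 2 * (p ^ (2 * j + 1) * M)" unfolding NM k
        by (simp add: power_add[symmetric] mult.assoc[symmetric] power2_eq_square)
      have d: "p ^ 2 dvd N" "N div p ^ 2 = p ^ (2 * j + 1) * M" "p dvd N div p ^ 2"
        using N' prime_gt_0_nat[OF p] by auto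
      define x' where "x' = p ^ (j + 1) * w"
      have x: "x = p * x'" using w k by (simp add: x'_def)
      have "x' * totient x' = N div p ^ 2"
        using mult_totient_mult_eq[OF x'_def _ p w(2)] d(2) by (simp add: M_def)
      moreover have "x' > 0" using x 2(4) by (auto intro: Nat.gr0I)
      moreover have "\<forall>q. prime q \<longrightarrow> q dvd x' \<longrightarrow> q \<in> set (p # ps)" using 2(6) x by auto
      ultimately have "mult_totient_inv (p # ps) (N div p ^ 2) = Some x'"
        by (intro 2(1)[OF g d(1,3)] 2(7,8))
      thus ?thesis using g d x by (simp only: mult_totient_inv.simps(2)[of p ps N] if_False if_True option.map)
    qed
  qed
qed

section \<open>Solutions of \<phi>(x^m) = n! with n at most 61\<close>

definition small_primes :: "nat list" where
  "small_primes = [61,59,53,47,43,41,37,31,29,23,19,17,13,11,7,5,3,2]"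

lemma prime_le_61:
  assumes "prime p" "p \<le> (61::nat)"
  shows "p \<in> set small_primes"
proof -
  have "\<forall>q\<in>set [2..<62]. prime q \<longrightarrow> q \<in> set small_primes"
    by (simp add: small_primes_def)
  moreover have "p \<in> set [2..<62]" using assms prime_ge_2_nat[of p] unfolding set_upt by simp
  ultimately show ?thesis using assms(1) by blast
qed

lemma totient_square: "totient (x ^ 2) = x * totient x"
  by (simp add: totient_power)

lemma prime_dvd_totient_power:
  fixes q x m :: nat
  assumes "prime q" "q dvd x" "m \<ge> 2"
  shows "q dvd totient (x ^ m)"
proof -
  have "x dvd x ^ (m - 1)" using assms by (intro dvd_power) auto
  hence "x dvd totient (x ^ m)" using assms by (simp add: totient_power)
  thus ?thesis using assms dvd_trans by blast
qed

lemma mult_totient_inv_fact: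
  fixes x n :: nat
  assumes "n \<le> 61" "x > 0" "totient (x ^ 2) = fact n"
  shows "mult_totient_inv small_primes (fact n) = Some x"
proof (rule mult_totient_inv_correct)
  show "\<forall>q. prime q \<longrightarrow> q dvd x \<longrightarrow> q \<in> set small_primes"
  proof (intro allI impI)
    fix q assume "prime q" "q dvd x"
    hence "q dvd fact n" using prime_dvd_totient_power[of q x 2] assms by simp
    thus "q \<in> set small_primes"
      using \<open>prime q\<close> assms by (intro prime_le_61) (auto simp: prime_dvd_fact_iff)
  qed
qed (use assms totient_square in \<open>auto simp: small_primes_def\<close>)

lemma totient_square_multiplicity:
  fixes x n p :: nat
  assumes "x > 0" "totient (x ^ 2) = fact n" "prime p"
  shows "2 * multiplicity p x - 1 + (\<Sum>q\<in>prime_factors x. multiplicity p (q - 1)) = multiplicity p (fact n)"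
  using multiplicity_totient[of p "x ^ 2"] assms
  by (simp add: prime_factors_power prime_elem_multiplicity_power_distrib)

text \<open>The exponent of \<open>p\<close> is 2 in \<open>fact n\<close> but odd or 0 in
  \<open>totient (x ^ 2)\<close>, since no prime of \<open>x\<close> is 1 modulo
  \<open>p\<close>.\<close>

lemma totient_square_neq_fact_middle:
  fixes x n p :: nat
  assumes "x > 0" "prime p" "p > 2" "2 * p \<le> n" "n < 3 * p" "\<not> prime (2 * p + 1) \<or> n < 2 * p + 1"
  shows "totient (x ^ 2) \<noteq> fact n"
proof
  assume eq: "totient (x ^ 2) = fact n"
  have "(\<Sum>q\<in>prime_factors x. multiplicity p (q - 1)) = 0"
  proof (intro sum.neutral ballI not_dvd_imp_multiplicity_0)
    fix q assume "q \<in> prime_factors x"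
    hence "prime q" "q dvd x" by auto
    moreover from this have "q \<le> n"
      using prime_dvd_totient_power[of q x 2] eq by (simp add: prime_dvd_fact_iff)
    ultimately show "\<not> p dvd q - 1" using no_prime_1_mod_middle[of p n q] assms by blast
  qed
  moreover have "multiplicity p (fact n) = 2" using assms by (intro multiplicity_fact) auto
  ultimately have "2 * multiplicity p x - 1 = 2"
    using totient_square_multiplicity[OF assms(1) eq assms(2)] by simp
  thus False by presburger
qed

text \<open>
  Here 23 must divide \<open>x\<close>, because 47 is the only prime in range that is 1 modulo 23. As 23 is the only
  one that is 1 modulo 11, the exponent of 11 in \<open>\<phi>(x\<^sup>2)\<close> is 1 or even, but it is 5 in \<open>n!\<close>.
\<close>

lemma totient_square_neq_fact_57_61:
  fixes x n :: nat
  assumes "x > 0" "n \<in> {57..61}"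
  shows "totient (x ^ 2) \<noteq> fact n"
proof
  assume eq: "totient (x ^ 2) = fact n"
  have sum: "(\<Sum>q\<in>prime_factors x. multiplicity p (q - 1)) = (if r dvd x then multiplicity p (r - 1) else 0)"
    if "prime r" and r: "\<forall>q\<in>set small_primes. q \<noteq> r \<longrightarrow> \<not> p dvd q - 1" for p r
  proof -
    have "(\<Sum>q\<in>prime_factors x. multiplicity p (q - 1)) =
        (\<Sum>q\<in>prime_factors x. if q = r then multiplicity p (r - 1) else 0)"
    proof (intro sum.cong refl)
      fix q assume "q \<in> prime_factors x"
      hence q: "prime q" "q dvd x" by auto
      hence "q dvd fact n" using prime_dvd_totient_power[of q x 2] eq by simp
      hence "q \<in> set small_primes"
        using q assms by (intro prime_le_61) (auto simp: prime_dvd_fact_iff)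
      thus "multiplicity p (q - 1) = (if q = r then multiplicity p (r - 1) else 0)"
        using r by (auto simp: not_dvd_imp_multiplicity_0)
    qed
    also have "\<dots> = (if r dvd x then multiplicity p (r - 1) else 0)"
      using assms \<open>prime r\<close> by (auto simp: in_prime_factors_iff)
    finally show ?thesis .
  qed
  have pr: "prime (11::nat)" "prime (23::nat)" "prime (47::nat)" by simp_all
  have "multiplicity 23 (fact n :: nat) = 2" using assms by (intro multiplicity_fact) auto
  moreover have "multiplicity 23 (46::nat) = 1" by (rule multiplicity_eqI) auto
  \<comment> \<open>If 23 did not divide \<open>x\<close>, its exponent in
    \<open>totient (x ^ 2)\<close> would come from 47 alone and be at most 1.\<close>
  ultimately have "23 dvd x"
    using totient_square_multiplicity[OF assms(1) eq pr(2)] sum[of 47 23]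
    by (cases "23 dvd x") (auto simp: small_primes_def not_dvd_imp_multiplicity_0 split: if_splits)
  moreover have "multiplicity 11 (fact n :: nat) = 5" using assms by (intro multiplicity_fact) auto
  moreover have "multiplicity 11 (22::nat) = 1" by (rule multiplicity_eqI) auto
  ultimately have "2 * multiplicity 11 x - 1 + 1 = 5"
    using totient_square_multiplicity[OF assms(1) eq pr(1)] sum[of 23 11] by (simp add: small_primes_def)
  thus False by presburger
qed

lemma totient_power_eq_factD:
  fixes x m n :: nat
  assumes "x > 0" "m \<ge> 2" "2 \<le> n" "n \<le> 61" "totient (x ^ m) = fact n"
  shows "m = 2"
proof (cases "n = 2")
  case True
  have "x \<le> 2" using le_totient_power[of 1 x m] assms True by simp
  moreover have "x \<noteq> 1" using assms True by auto
  ultimately have "x = 2" using assms by simp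
  hence "2 ^ (m - 1) = (2 ^ 1 :: nat)" using assms True by (simp add: totient_power)
  hence "m - 1 = 1" by (subst (asm) power_inject_exp) auto
  thus ?thesis using assms by simp
next
  case False
  \<comment> \<open>The intervals \<open>[p, 2p)\<close> of these primes cover 3 to 61. The value
    \<open>n = 2\<close> is apart because \<open>p\<close> has to be odd.\<close>
  have "\<exists>p\<in>{3, 5, 7, 13, 23, 43}. p \<le> n \<and> n < 2 * p"
    using assms False by simp linarith
  then obtain p where p: "p \<in> {3, 5, 7, 13, 23, 43}" "p \<le> n" "n < 2 * p" by blast
  from p(1) have p': "prime p" "p > 2" by auto
  have "\<not> p dvd q - 1" if "prime q" "q dvd x ^ m" for q
  proof -
    have "q dvd x" using that prime_dvd_power by blast
    hence "q \<le> n" using prime_dvd_totient_power[of q x m] assms that by (simp add: prime_dvd_fact_iff)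
    thus ?thesis using no_prime_1_mod_upper_half[of p n q] p p' that by blast
  qed
  hence "multiplicity p (x ^ m) - 1 = multiplicity p (totient (x ^ m))"
    using multiplicity_totient_eq[of p "x ^ m"] p' assms by simp
  also have "\<dots> = 1" unfolding assms(5) using p p' by (intro multiplicity_fact) auto
  finally have "m * multiplicity p x = 2"
    using p' assms by (simp add: prime_elem_multiplicity_power_distrib)
  hence "m dvd 2" by (metis dvd_triv_left)
  thus ?thesis using assms dvd_imp_le[of m 2] by simp
qed

lemma mult_totient_inv_small:
  "mult_totient_inv small_primes (fact 2) = Some 2" "mult_totient_inv small_primes (fact 3) = Some 3"
  "mult_totient_inv small_primes (fact 4) = None" "mult_totient_inv small_primes (fact 5) = Some 15"
  "mult_totient_inv small_primes (fact 7) = Some 105"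
  "mult_totient_inv small_primes (fact 8) = Some 420" "mult_totient_inv small_primes (fact 9) = Some 1260"
  "mult_totient_inv small_primes (fact 11) = Some 13860"
  "mult_totient_inv small_primes (fact 12) = None" "mult_totient_inv small_primes (fact 13) = Some 180180"
  by (simp_all add: mult_totient_inv.simps(2) small_primes_def fact_numeral)

lemma mult_totient_inv_21: "mult_totient_inv small_primes (fact 21) = None"
  by (simp add: mult_totient_inv.simps(2) small_primes_def fact_numeral)

lemma mult_totient_inv_23: "mult_totient_inv small_primes (fact 23) = None"
  by (simp add: mult_totient_inv.simps(2) small_primes_def fact_numeral)

lemma mult_totient_inv_24: "mult_totient_inv small_primes (fact 24) = None"
  by (simp add: mult_totient_inv.simps(2) small_primes_def fact_numeral)

lemma mult_totient_inv_25: "mult_totient_inv small_primes (fact 25) = None"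
  by (simp add: mult_totient_inv.simps(2) small_primes_def fact_numeral)

lemma totient_square_eq_factD:
  fixes x n :: nat
  assumes "x > 0" "2 \<le> n" "n \<le> 61" "totient (x ^ 2) = fact n"
  shows "(x, n) \<in> {(2,2), (3,3), (15,5), (105,7), (420,8), (1260,9), (13860,11), (180180,13)}"
proof -
  \<comment> \<open>In a triple \<open>(p, l, u)\<close> the prime \<open>p\<close> excludes every
    \<open>n\<close> from \<open>l = 2 * p\<close> to \<open>u\<close>; here \<open>u\<close> is
    \<open>3 * p - 1\<close>, or only \<open>2 * p\<close> when \<open>2 * p + 1\<close> is prime.
    The values left over form \<open>?S\<close>: those up to 25 are decided by descent, those from
    57 on by the argument with 11 and 23.\<close>
  let ?T = "{(3,6,6),(5,10,10),(7,14,20),(11,22,22),(13,26,38),(17,34,50),(19,38,56),(29,58,58)} :: (nat \<times> nat \<times> nat) set"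
  let ?S = "{2,3,4,5,7,8,9,11,12,13,21,23,24,25,57,59,60,61} :: nat set"
  have "\<forall>n\<in>set [2..<62]. n \<in> ?S \<or> (\<exists>(p,l,u)\<in>?T. l \<le> n \<and> n \<le> u)"
    by simp
  moreover have "n \<in> set [2..<62]" unfolding set_upt using assms(2,3) by simp
  ultimately have "n \<in> ?S \<or> (\<exists>(p,l,u)\<in>?T. l \<le> n \<and> n \<le> u)"
    by (rule bspec)
  moreover have False if "(p,l,u) \<in> ?T" "l \<le> n" "n \<le> u" for p l u
  proof -
    from that have "prime p \<and> p > 2 \<and> 2 * p \<le> n \<and> n < 3 * p \<and> (\<not> prime (2 * p + 1) \<or> n < 2 * p + 1)"
      by (elim insertE emptyE) simp_all
    thus False using totient_square_neq_fact_middle[OF assms(1), of p n] assms(4) by blast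
  qed
  ultimately have "n \<in> ?S" by blast
  thus ?thesis
    using mult_totient_inv_fact[OF assms(3,1,4)] mult_totient_inv_small mult_totient_inv_21 mult_totient_inv_23 mult_totient_inv_24 mult_totient_inv_25
      totient_square_neq_fact_57_61[OF assms(1), of n] assms(4)
    by (elim insertE) auto
qed

theorem theorem1:
  "(\<forall>a b c m :: nat.
      a > 0 \<longrightarrow> b > 0 \<longrightarrow> c > 0 \<longrightarrow> coprime b c \<longrightarrow> m \<ge> 2 \<longrightarrow>
        finite {(x :: nat, n :: nat). x > 0 \<and> n > 0 \<and>
          real (totient (a * x ^ m)) = real b * fact n / real c} \<and>
        (\<forall>x n :: nat. x > 0 \<longrightarrow> n > 0 \<longrightarrow>
          real (totient (a * x ^ m)) = real b * fact n / real c \<longrightarrow>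
          n \<le> Max {61, 3 * a, 3 * b, 3 * c})) \<and>
   {(m :: nat, x :: nat, n :: nat). m \<ge> 2 \<and> x > 0 \<and> n > 0 \<and> totient (x ^ m) = fact n} =
     {(m, x, n). m \<ge> 2 \<and> x = 1 \<and> n = 1} \<union>
     {(2, 2, 2),
      (2, 3, 3),
      (2, 3 * 5, 5),
      (2, 3 * 5 * 7, 7),
      (2, 2^2 * 3 * 5 * 7, 8),
      (2, 2^2 * 3^2 * 5 * 7, 9),
      (2, 2^2 * 3^2 * 5 * 7 * 11, 11),
      (2, 2^2 * 3^2 * 5 * 7 * 11 * 13, 13)}"
proof (intro conjI allI impI)
  fix a b c m :: nat
  assume pos: "a > 0" "b > 0" "c > 0" "m \<ge> 2"
  let ?P = "\<lambda>x n. real (totient (a * x ^ m)) = real b * fact n / real c"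
  let ?N = "Max {61, 3 * a, 3 * b, 3 * c}"
  have P: "c * totient (a * x ^ m) = b * fact n" if "?P x n" for x n :: nat
  proof -
    from that pos have "real (c * totient (a * x ^ m)) = real (b * fact n)"
      by (simp add: field_simps)
    thus ?thesis by (simp only: of_nat_eq_iff)
  qed
  show bound: "n \<le> ?N" if "x > 0" "?P x n" for x n :: nat
    using totient_power_equation_bound[OF pos that(1) P[OF that(2)] prime_1_mod_3_between] .
  \<comment> \<open>Both coordinates are bounded: \<open>x\<close> is at most
    \<open>totient (a * x ^ m)\<close>, hence at most \<open>b * fact n\<close>.\<close>
  have "{(x, n). x > 0 \<and> n > 0 \<and> ?P x n} \<subseteq> {..b * fact ?N} \<times> {..?N}"
  proof clarify
    fix x n :: nat
    assume x: "x > 0" and xn: "?P x n"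
    have "x \<le> totient (a * x ^ m)" using pos x by (intro le_totient_power) auto
    also have "\<dots> \<le> c * totient (a * x ^ m)" using pos by simp
    also have "\<dots> = b * fact n" by (rule P[OF xn])
    also have "\<dots> \<le> b * fact ?N" using bound[OF x xn] by (intro mult_left_mono fact_mono) auto
    finally show "x \<in> {..b * fact ?N} \<and> n \<in> {..?N}" using bound[OF x xn] by blast
  qed
  thus "finite {(x, n). x > 0 \<and> n > 0 \<and> ?P x n}"
    by (rule finite_subset) blast
next
  have sol: "x = 1 \<and> n = 1 \<or> m = 2 \<and>
      (x, n) \<in> {(2,2), (3,3), (15,5), (105,7), (420,8), (1260,9), (13860,11), (180180,13)}"
    if "m \<ge> 2" "x > 0" "n > 0" and eq: "totient (x ^ m) = fact n" for m x n :: nat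
  proof (cases "n = 1")
    case True
    have "x \<le> 1" using le_totient_power[of 1 x m] that True by simp
    thus ?thesis using that True by simp
  next
    case False
    have "n \<le> Max {61, 3 * 1, 3 * 1, 3 * 1}"
      using that by (intro totient_power_equation_bound[of 1 1 1 m x n] prime_1_mod_3_between) auto
    hence n: "2 \<le> n" "n \<le> 61" using False that by auto
    have "m = 2" using that n by (intro totient_power_eq_factD) auto
    thus ?thesis using totient_square_eq_factD[of x n] that n by simp
  qed
  have ex: "totient (x ^ 2) = fact n"
    if "(x, n) \<in> {(2,2), (3,3), (15,5), (105,7), (420,8), (1260,9), (13860,11), (180180,13)}" for x n :: nat
  proof -
    have p: "totient (p ^ k * w) = p ^ (k - 1) * (p - 1) * totient w"
      if "prime p" "k > 0" "\<not> p dvd w" for p k w :: nat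
      using that by (simp add: totient_mult_coprime totient_prime_power prime_imp_coprime)
    have sq: "totient (x ^ 2) = x * totient x" for x by (rule totient_square)
    \<comment> \<open>Each totient is obtained by splitting off one prime power from a smaller
      argument, such as \<open>1260 = 3 ^ 2 * 140\<close>.\<close>
    have "totient 15 = 8" "totient 35 = 24" using p[of 3 1 5] p[of 7 1 5] totient_prime[of 5] by simp_all
    hence "totient 105 = 48" "totient 140 = 48" using p[of 7 1 15] p[of 2 2 35] by simp_all
    hence "totient 420 = 96" "totient 1260 = 288" using p[of 2 2 105] p[of 3 2 140] by simp_all
    moreover from this have "totient 13860 = 2880" using p[of 11 1 1260] by simp
    moreover from this have "totient 180180 = 34560" using p[of 13 1 13860] by simp
    moreover have "totient 3 = 2" using totient_prime[of 3] by simp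
    ultimately show ?thesis using that \<open>totient 15 = 8\<close> \<open>totient 105 = 48\<close> unfolding sq
      by (elim insertE emptyE Pair_inject; hypsubst) (simp_all add: fact_numeral)
  qed
  show "{(m :: nat, x :: nat, n :: nat). m \<ge> 2 \<and> x > 0 \<and> n > 0 \<and> totient (x ^ m) = fact n} =
     {(m, x, n). m \<ge> 2 \<and> x = 1 \<and> n = 1} \<union>
     {(2, 2, 2),
      (2, 3, 3),
      (2, 3 * 5, 5),
      (2, 3 * 5 * 7, 7),
      (2, 2^2 * 3 * 5 * 7, 8),
      (2, 2^2 * 3^2 * 5 * 7, 9),
      (2, 2^2 * 3^2 * 5 * 7 * 11, 11),
      (2, 2^2 * 3^2 * 5 * 7 * 11 * 13, 13)}" (is "?L = ?R")
  proof (rule set_eqI)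
    fix t :: "nat \<times> nat \<times> nat"
    obtain m x n where t: "t = (m, x, n)" by (cases t)
    have R: "t \<in> ?R \<longleftrightarrow> m \<ge> 2 \<and> x = 1 \<and> n = 1 \<or> m = 2 \<and>
        (x, n) \<in> {(2,2), (3,3), (15,5), (105,7), (420,8), (1260,9), (13860,11), (180180,13)}"
      unfolding t by auto
    have pos: "x > 0 \<and> n > 0"
      if "(x, n) \<in> {(2,2), (3,3), (15,5), (105,7), (420,8), (1260,9), (13860,11), (180180,13)}"
      using that by auto
    have L: "t \<in> ?L \<longleftrightarrow> m \<ge> 2 \<and> x > 0 \<and> n > 0 \<and> totient (x ^ m) = fact n"
      unfolding t by simp
    show "t \<in> ?L \<longleftrightarrow> t \<in> ?R"
    proof
      assume "t \<in> ?L"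
      thus "t \<in> ?R" unfolding L R using sol[of m x n] by blast
    next
      assume "t \<in> ?R"
      thus "t \<in> ?L" unfolding R
      proof
        assume "m \<ge> 2 \<and> x = 1 \<and> n = 1"
        thus "t \<in> ?L" unfolding L by simp
      next
        assume "m = 2 \<and> (x, n) \<in> {(2,2), (3,3), (15,5), (105,7), (420,8), (1260,9), (13860,11), (180180,13)}"
        thus "t \<in> ?L" unfolding L using pos ex[of x n] by blast
      qed
    qed
  qed
qed

end
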